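(* The expected profit $g(\mu,\sigma)$ obtained by optimal forward contracting is no worse than the indirect profit $h(1)$ obtained by only using purchases at initial prices; that is, $$h(1)<g(\mu,\sigma)=E[h(b_\theta\wedge\tilde b)].$$
   Context: $f:[0,\infty)\to[0,\infty)$ is an Inada-type function: twice differentiable, increasing unboundedly from $f(0)=0$, with slope $f'$ unbounded at the origin and strictly decreasing to zero at infinity (so $f$ is strictly concave). The indirect profit at a deterministic price $b>0$ is $h(b)=\max_{x>0}[f(x)-bx]$. The price process $b_t$ satisfies $db_t/b_t=\bar\mu\,dt+\bar\sigma\,dw_t$, $b_0=1$, where $w_t$ is a standard Wiener process and $\bar\mu>0$, $\bar\sigma>0$ are constants. Fix $0<\theta<1$ and write $\mu=\bar\mu\theta$, $\sigma=\bar\sigma\sqrt\theta$; thus $\ln b_\theta$ is normal with mean $\mu-\tfrac12\sigma^2$ and variance $\sigma^2$. The censor $\tilde b$ is the scalar solving $E[b_\theta\wedge\tilde b]=1$, where $x\wedge y=\min(x,y)$. The profit $g$ is defined by $g(\mu,\sigma)=E[h(b_\theta)\mathbf 1_{\{b_\theta\le\tilde b\}}]+h(\tilde b)\cdot\Pr[b_\theta>\tilde b]$. *)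

theory Defs
  imports "HOL-Probability.Probability"
begin

section \<open>Production function and indirect profit\<close>

text \<open>
  A function on the half line is a total function on the reals whose values at negative
  arguments are irrelevant. Differentiability is required on the open half line only, since the
  slope is unbounded at the origin.
\<close>

definition inada :: "(real \<Rightarrow> real) \<Rightarrow> bool" where
  "inada f \<longleftrightarrow>
     f 0 = 0 \<and> (\<forall>x\<ge>0. f x \<ge> 0) \<and>
     strict_mono_on {0..} f \<and> filterlim f at_top at_top \<and>
     (\<forall>x>0. f differentiable (at x) \<and> deriv f differentiable (at x)) \<and>
     filterlim (deriv f) at_top (at_right 0) \<and>
     strict_antimono_on {0<..} (deriv f) \<and>
     (deriv f \<longlongrightarrow> 0) at_top"

definition indirect_profit :: "(real \<Rightarrow> real) \<Rightarrow> real \<Rightarrow> real" where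
  "indirect_profit f p = (GREATEST y. \<exists>x>0. y = f x - p * x)"


section \<open>Price process\<close>

definition wiener_process :: "'a measure \<Rightarrow> (real \<Rightarrow> 'a \<Rightarrow> real) \<Rightarrow> bool" where
  "wiener_process M w \<longleftrightarrow>
     (\<forall>t\<ge>0. w t \<in> borel_measurable M) \<and>
     (AE \<omega> in M. w 0 \<omega> = 0) \<and>
     (AE \<omega> in M. continuous_on {0..} (\<lambda>t. w t \<omega>)) \<and>
     (\<forall>s t. 0 \<le> s \<and> s < t \<longrightarrow>
        distributed M lborel (\<lambda>\<omega>. w t \<omega> - w s \<omega>) (normal_density 0 (sqrt (t - s)))) \<and>
     (\<forall>n (\<tau> :: nat \<Rightarrow> real). 0 \<le> \<tau> 0 \<and> (\<forall>i<n. \<tau> i \<le> \<tau> (Suc i)) \<longrightarrow>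
        prob_space.indep_vars M (\<lambda>_. borel)
          (\<lambda>i \<omega>. w (\<tau> (Suc i)) \<omega> - w (\<tau> i) \<omega>) {..<n})"

definition partition_points :: "real \<Rightarrow> nat \<Rightarrow> (nat \<Rightarrow> real) \<Rightarrow> bool" where
  "partition_points t n \<tau> \<longleftrightarrow> \<tau> 0 = 0 \<and> \<tau> n = t \<and> (\<forall>i<n. \<tau> i \<le> \<tau> (Suc i))"

text \<open>
  \<open>I\<close> is the Ito integral of \<open>X\<close> against \<open>Y\<close> over the interval from \<open>0\<close> to \<open>t\<close>: the limit in
  probability of the left-endpoint sums as the mesh of the partition tends to zero. For a
  continuous adapted integrand and a continuous semimartingale integrator this is the usual
  stochastic integral.
\<close>

definition has_ito_integral ::
    "'a measure \<Rightarrow> (real \<Rightarrow> 'a \<Rightarrow> real) \<Rightarrow> (real \<Rightarrow> 'a \<Rightarrow> real) \<Rightarrow> real \<Rightarrow> ('a \<Rightarrow> real) \<Rightarrow> bool" where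
  "has_ito_integral M X Y t I \<longleftrightarrow>
     (\<forall>\<epsilon>>0. \<forall>\<eta>>0. \<exists>\<delta>>0. \<forall>n \<tau>.
        partition_points t n \<tau> \<and> (\<forall>i<n. \<tau> (Suc i) - \<tau> i < \<delta>) \<longrightarrow>
        measure M {\<omega> \<in> space M.
          \<bar>(\<Sum>i<n. X (\<tau> i) \<omega> * (Y (\<tau> (Suc i)) \<omega> - Y (\<tau> i) \<omega>)) - I \<omega>\<bar> > \<epsilon>} < \<eta>)"

text \<open>
  The equation \<open>db/b = \<mu> dt + \<sigma> dw\<close>, \<open>b\<^sub>0 = 1\<close>, in integrated form: for every \<open>t\<close>, the Ito integral
  of \<open>1/b\<close> against \<open>b\<close> over the interval from \<open>0\<close> to \<open>t\<close> is \<open>\<mu> t + \<sigma> w\<^sub>t\<close>. Adaptedness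
  of \<open>b\<close> need not be demanded, because the equation determines \<open>b\<close> from \<open>w\<close> almost surely.
\<close>

definition price_process ::
    "'a measure \<Rightarrow> real \<Rightarrow> real \<Rightarrow> (real \<Rightarrow> 'a \<Rightarrow> real) \<Rightarrow> (real \<Rightarrow> 'a \<Rightarrow> real) \<Rightarrow> bool" where
  "price_process M \<mu> \<sigma> w b \<longleftrightarrow>
     (\<forall>t\<ge>0. b t \<in> borel_measurable M) \<and>
     (AE \<omega> in M. b 0 \<omega> = 1) \<and>
     (AE \<omega> in M. \<forall>t\<ge>0. b t \<omega> > 0) \<and>
     (AE \<omega> in M. continuous_on {0..} (\<lambda>t. b t \<omega>)) \<and>
     (\<forall>t\<ge>0. has_ito_integral M (\<lambda>s \<omega>. 1 / b s \<omega>) b t (\<lambda>\<omega>. \<mu> * t + \<sigma> * w t \<omega>))"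


section \<open>Censor and expected profit\<close>

definition censor :: "'a measure \<Rightarrow> ('a \<Rightarrow> real) \<Rightarrow> real" where
  "censor M B = (THE c. (\<integral>\<omega>. min (B \<omega>) c \<partial>M) = 1)"

text \<open>
  The indirect profit is nonnegative at positive prices but may grow so fast as the price tends
  to zero that its expectation is infinite, whereas the Bochner integral of a non-integrable
  function is \<open>0\<close>. Expected profits are therefore extended nonnegative reals.
\<close>

definition expected_profit :: "'a measure \<Rightarrow> (real \<Rightarrow> real) \<Rightarrow> ('a \<Rightarrow> real) \<Rightarrow> ennreal" where
  "expected_profit M f B =
     (\<integral>\<^sup>+\<omega>. ennreal (indirect_profit f (B \<omega>)) * indicator {\<omega>. B \<omega> \<le> censor M B} \<omega> \<partial>M)
     + ennreal (indirect_profit f (censor M B))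
       * emeasure M {\<omega> \<in> space M. B \<omega> > censor M B}"

end

theory Submission
  imports Defs
begin

text \<open>
  Let \<open>B\<close> be the price at time \<open>\<theta>\<close>, \<open>c\<close> its censor and \<open>h\<close> the indirect profit. As a maximum of
  functions that are affine in the price, \<open>h\<close> is convex, and it is strictly convex because the
  slope of \<open>f\<close> takes each positive value at a single point. The censored price \<open>min B c\<close> has mean
  \<open>1\<close>, so the strict inequality is Jensen's inequality for \<open>h\<close>, provided that \<open>min B c\<close> is not almost
  surely equal to \<open>1\<close> (\<open>strict_jensen_indirect_profit\<close>). The equation for the expected profit only
  splits the expectation of \<open>h (min B c)\<close> along the event \<open>B \<le> c\<close>.

  Two facts about the distribution of \<open>B\<close> enter. Its mean exceeds \<open>1\<close>; hence the mean of
  \<open>min B c\<close>, which is continuous in \<open>c\<close> and strictly increasing until it reaches the mean of \<open>B\<close>, takes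
  the value \<open>1\<close> exactly once, and the censor is well defined (\<open>expectation_min_censor\<close>). And \<open>B < 1\<close>
  has positive probability, so that \<open>min B c\<close> is not constant. Both hold since \<open>B\<close> is lognormal with
  mean \<open>exp (\<mu> \<theta>)\<close>.

  That \<open>B\<close> is lognormal has to be extracted from the stochastic differential equation, and this is
  done without an Ito formula (\<open>log_price_eq\<close>). Write \<open>x = ln b\<close> and \<open>y t = \<mu> t + \<sigma> w t\<close>. The Ito
  sums of \<open>1/b\<close> against \<open>b\<close> are the sums of \<open>exp (\<Delta>x) - 1\<close>, and they converge to \<open>y t\<close> in probability.
  Since \<open>exp z - 1 \<ge> z\<close>, they dominate the increments of \<open>x\<close>; so \<open>A = y - x\<close> is nondecreasing. A
  continuous monotone part contributes nothing to quadratic variation, whence \<open>x = y - A\<close>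
  has the quadratic variation \<open>\<sigma>\<^sup>2 t\<close> of \<open>y\<close>. By the expansion of the exponential, the sums of
  \<open>exp (\<Delta>x) - 1\<close> then converge to \<open>x t - x 0 + \<sigma>\<^sup>2 t / 2\<close> as well. Comparing the two limits gives
  \<open>x t = y t - \<sigma>\<^sup>2 t / 2\<close>.
\<close>

section \<open>Strict convexity of the indirect profit\<close>

lemma inada_has_deriv:
  assumes "inada f" "x > 0"
  shows "(f has_real_derivative deriv f x) (at x)"
  using assms unfolding inada_def by (metis DERIV_deriv_iff_real_differentiable)

text \<open>
  The slope is strictly decreasing, so the mean value theorem puts every chord below the tangent.
\<close>

lemma inada_below_tangent:
  assumes f: "inada f" and "x > 0" "y > 0" "y \<noteq> x"
  shows "f y < f x + deriv f x * (y - x)"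
proof -
  have anti: "deriv f v < deriv f u" if "0 < u" "u < v" for u v
    using f that unfolding inada_def by (auto simp: monotone_on_def)
  have D: "(f has_real_derivative deriv f z) (at z)" if "z > 0" for z
    using inada_has_deriv[OF f that] .
  show ?thesis
  proof (cases "x < y")
    case True
    then obtain z where z: "x < z" "z < y" "f y - f x = (y - x) * deriv f z"
      using MVT2[of x y f "deriv f"] D assms by force
    have "(y - x) * deriv f z < (y - x) * deriv f x"
      using anti[of x z] z True assms by (intro mult_strict_left_mono) auto
    with z show ?thesis by (simp add: algebra_simps)
  next
    case False
    then have "y < x" using assms by simp
    then obtain z where z: "y < z" "z < x" "f x - f y = (x - y) * deriv f z"
      using MVT2[of y x f "deriv f"] D assms by force
    have "(x - y) * deriv f x < (x - y) * deriv f z"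
      using anti[of z x] z \<open>y < x\<close> assms by (intro mult_strict_left_mono) auto
    with z show ?thesis by (simp add: algebra_simps)
  qed
qed

text \<open>
  The slope is continuous on the open half line, and it is unbounded at the origin and tends to zero at infinity.
\<close>

lemma inada_marginal_price_attained:
  assumes f: "inada f" and "p > 0"
  obtains x where "x > 0" "deriv f x = p"
proof -
  have "eventually (\<lambda>x. deriv f x > p) (at_right 0)"
    using f unfolding inada_def filterlim_at_top_dense by blast
  then obtain a where a: "a > 0" "deriv f a > p"
    unfolding eventually_at_right_field by (metis field_lbound_gt_zero)
  have "eventually (\<lambda>x. deriv f x < p) at_top"
    using f \<open>p > 0\<close> unfolding inada_def by (auto dest: order_tendstoD)
  then obtain c where c: "c > a" "deriv f c < p"
    unfolding eventually_at_top_dense by (metis gt_ex linorder_less_linear order.strict_trans)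
  have "continuous_on {a..c} (deriv f)"
    using f a unfolding inada_def
    by (intro continuous_at_imp_continuous_on) (auto intro!: differentiable_imp_continuous_within)
  then obtain x where "a \<le> x" "x \<le> c" "deriv f x = p"
    using IVT2'[of "deriv f" c p a] a c by auto
  then show thesis using a that[of x] by simp
qed

text \<open>
  The first-order condition: a plan with marginal product \<open>p\<close> is optimal at the price \<open>p\<close>. With the
  preceding lemma the maximum that defines the indirect profit exists at every positive price.
\<close>

lemma indirect_profit_eq:
  assumes f: "inada f" and "x > 0"
  shows "indirect_profit f (deriv f x) = f x - deriv f x * x"
  unfolding indirect_profit_def
proof (rule Greatest_equality)
  show "\<exists>z>0. f x - deriv f x * x = f z - deriv f x * z" using \<open>x > 0\<close> by blast
next
  fix v assume "\<exists>z>0. v = f z - deriv f x * z"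
  then obtain z where "z > 0" "v = f z - deriv f x * z" by blast
  then show "v \<le> f x - deriv f x * x"
    using inada_below_tangent[OF f \<open>x > 0\<close>, of z] by (cases "z = x") (auto simp: algebra_simps)
qed

text \<open>
  The strict version, which is where strict convexity of the indirect profit comes from, holds since
  an optimal plan satisfies the first-order condition.
\<close>

lemma indirect_profit_ge:
  assumes f: "inada f" and "p > 0" "x > 0"
  shows "f x - p * x \<le> indirect_profit f p"
    and "deriv f x \<noteq> p \<Longrightarrow> f x - p * x < indirect_profit f p"
proof -
  obtain y where y: "y > 0" "deriv f y = p"
    using inada_marginal_price_attained[OF f \<open>p > 0\<close>] .
  have *: "x \<noteq> y \<Longrightarrow> f x - p * x < indirect_profit f p"
    using inada_below_tangent[OF f y(1) \<open>x > 0\<close>] indirect_profit_eq[OF f y(1)] y(2)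
    by (simp add: algebra_simps)
  then show "f x - p * x \<le> indirect_profit f p"
    using indirect_profit_eq[OF f y(1)] y(2) by (cases "x = y") auto
  show "f x - p * x < indirect_profit f p" if "deriv f x \<noteq> p"
    using * that y(2) by blast
qed

text \<open>
  Small plans lose arbitrarily little, as \<open>f\<close> is nonnegative.
\<close>

lemma indirect_profit_nonneg:
  assumes f: "inada f" and "p > 0"
  shows "0 \<le> indirect_profit f p"
proof (rule ccontr)
  let ?h = "indirect_profit f p"
  assume "\<not> 0 \<le> ?h"
  then have neg: "?h < 0" by simp
  define x where "x = - ?h / (2 * p)"
  have "x > 0" using neg \<open>p > 0\<close> unfolding x_def by (simp add: divide_neg_pos)
  moreover from this have "f x \<ge> 0" using f unfolding inada_def by simp
  moreover have "p * x = - ?h / 2" using \<open>p > 0\<close> by (simp add: x_def)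
  ultimately show False using indirect_profit_ge(1)[OF f \<open>p > 0\<close>, of x] neg by simp
qed

lemma indirect_profit_antimono:
  assumes f: "inada f" and "0 < p" "p \<le> q"
  shows "indirect_profit f q \<le> indirect_profit f p"
proof -
  obtain y where y: "y > 0" "deriv f y = q"
    using inada_marginal_price_attained[OF f, of q] assms by auto
  have "indirect_profit f q = f y - q * y" using indirect_profit_eq[OF f y(1)] y(2) by simp
  also have "\<dots> \<le> f y - p * y" using assms y by (simp add: mult_right_mono)
  also have "\<dots> \<le> indirect_profit f p" using indirect_profit_ge(1)[OF f] assms y by simp
  finally show ?thesis .
qed

text \<open>
  Keeping the plan \<open>x\<close> that is optimal at the price \<open>p\<close> earns an amount affine in the actual price \<open>q\<close>, and
  for \<open>q \<noteq> p\<close> that plan is no longer optimal. This is strict convexity in the form in which Jensen's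
  inequality uses it.
\<close>

lemma indirect_profit_above_support_line:
  assumes f: "inada f" and "p > 0"
  obtains x where "x > 0"
    "\<And>q. q > 0 \<Longrightarrow> q \<noteq> p \<Longrightarrow> indirect_profit f p - (q - p) * x < indirect_profit f q"
proof -
  obtain x where x: "x > 0" "deriv f x = p"
    using inada_marginal_price_attained[OF f \<open>p > 0\<close>] .
  have "indirect_profit f p - (q - p) * x < indirect_profit f q" if "q > 0" "q \<noteq> p" for q
    using indirect_profit_ge(2)[OF f that(1) x(1)] indirect_profit_eq[OF f x(1)] x(2) that(2)
    by (simp add: algebra_simps)
  with x(1) show thesis by (rule that)
qed

text \<open>
  At prices that are not positive the maximum need not exist and \<open>GREATEST\<close> is arbitrary; the
  constant \<open>0\<close> makes the function measurable on the whole line without a change at positive prices.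
\<close>

lemma indirect_profit_measurable:
  assumes f: "inada f"
  shows "(\<lambda>p. if p > 0 then indirect_profit f p else 0) \<in> borel_measurable borel"
proof -
  have "mono_on {0<..} (\<lambda>p. - indirect_profit f p)"
    using indirect_profit_antimono[OF f] by (auto simp: monotone_on_def)
  then have "(\<lambda>p. - indirect_profit f p) \<in> borel_measurable (restrict_space borel {0<..})"
    by (rule borel_measurable_mono_on_fnc)
  then have "indirect_profit f \<in> borel_measurable (restrict_space borel {0<..})"
    by simp
  then show ?thesis
    by (subst (asm) measurable_restrict_space_iff[where c = 0]) (auto simp: if_distrib)
qed


section \<open>Quadratic variation of Brownian motion\<close>

context prob_space
begin

text \<open>
  Independent centred variables are orthogonal, so the cross terms vanish.
\<close>

lemma second_moment_indep_sum:
  fixes X :: "'i \<Rightarrow> 'a \<Rightarrow> real"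
  assumes "finite I" "indep_vars (\<lambda>_. borel) X I"
    and "\<And>i. i \<in> I \<Longrightarrow> integrable M (\<lambda>\<omega>. (X i \<omega>)\<^sup>2)" "\<And>i. i \<in> I \<Longrightarrow> expectation (X i) = 0"
  shows "integrable M (\<lambda>\<omega>. (\<Sum>i\<in>I. X i \<omega>)\<^sup>2)
    \<and> expectation (\<lambda>\<omega>. (\<Sum>i\<in>I. X i \<omega>)\<^sup>2) = (\<Sum>i\<in>I. expectation (\<lambda>\<omega>. (X i \<omega>)\<^sup>2))"
  using assms
proof (induction I rule: finite_induct)
  case empty
  then show ?case by simp
next
  case (insert j I)
  let ?S = "\<lambda>\<omega>. \<Sum>i\<in>I. X i \<omega>"
  have rv: "random_variable borel (X i)" if "i \<in> insert j I" for i
    using insert.prems(1) that by (auto simp: indep_vars_def)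
  have int: "integrable M (X i)" if "i \<in> insert j I" for i
    using square_integrable_imp_integrable[OF rv[OF that] insert.prems(2)[OF that]] .
  have IH: "integrable M (\<lambda>\<omega>. (?S \<omega>)\<^sup>2)"
    "expectation (\<lambda>\<omega>. (?S \<omega>)\<^sup>2) = (\<Sum>i\<in>I. expectation (\<lambda>\<omega>. (X i \<omega>)\<^sup>2))"
    using insert.IH[OF indep_vars_subset[OF insert.prems(1)]] insert.prems by auto
  have iS: "integrable M ?S" using int by auto
  have ind: "indep_var borel (X j) borel ?S"
    using insert by (intro indep_vars_sum) auto
  have iX: "integrable M (X j)" and iX2: "integrable M (\<lambda>\<omega>. (X j \<omega>)\<^sup>2)"
    using int insert.prems by auto
  note cross = indep_var_integrable[OF ind iX iS] indep_var_lebesgue_integral[OF ind iX iS]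
  have eq: "(\<Sum>i\<in>insert j I. X i \<omega>)\<^sup>2 = (X j \<omega>)\<^sup>2 + (?S \<omega>)\<^sup>2 + 2 * (X j \<omega> * ?S \<omega>)" for \<omega>
    using insert.hyps by (simp add: power2_sum)
  have "expectation (\<lambda>\<omega>. (X j \<omega>)\<^sup>2 + (?S \<omega>)\<^sup>2 + 2 * (X j \<omega> * ?S \<omega>))
    = expectation (\<lambda>\<omega>. (X j \<omega>)\<^sup>2) + expectation (\<lambda>\<omega>. (?S \<omega>)\<^sup>2)
      + 2 * expectation (\<lambda>\<omega>. X j \<omega> * ?S \<omega>)"
    using iX2 IH(1) cross(1) by simp
  then show ?case
    unfolding eq using iX2 IH cross insert.hyps insert.prems(3)[of j] by simp
qed

text \<open>
  The second moment of a normal variable is \<open>s\<^sup>2\<close> and the fourth is \<open>3 s\<^sup>4\<close>.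
\<close>

lemma normal_square_moments:
  assumes D: "distributed M lborel Z (normal_density 0 s)" and "s > 0"
  shows "integrable M (\<lambda>\<omega>. ((Z \<omega>)\<^sup>2 - s\<^sup>2)\<^sup>2)"
    and "expectation (\<lambda>\<omega>. (Z \<omega>)\<^sup>2 - s\<^sup>2) = 0"
    and "expectation (\<lambda>\<omega>. ((Z \<omega>)\<^sup>2 - s\<^sup>2)\<^sup>2) = 2 * s ^ 4"
proof -
  have I: "integrable M (\<lambda>\<omega>. Z \<omega> ^ (2 * k))"
    and E: "expectation (\<lambda>\<omega>. Z \<omega> ^ (2 * k)) = fact (2 * k) / ((2 / s\<^sup>2) ^ k * fact k)" for k
  proof -
    have m: "has_bochner_integral lborel (\<lambda>x. normal_density 0 s x * x ^ (2 * k))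
        (fact (2 * k) / ((2 / s\<^sup>2) ^ k * fact k))"
      using normal_moment_even[OF \<open>s > 0\<close>, of 0 k] by simp
    show "integrable M (\<lambda>\<omega>. Z \<omega> ^ (2 * k))"
      using distributed_integrable[OF D, of "\<lambda>x. x ^ (2 * k)"] integrable.intros[OF m] by simp
    show "expectation (\<lambda>\<omega>. Z \<omega> ^ (2 * k)) = fact (2 * k) / ((2 / s\<^sup>2) ^ k * fact k)"
      using distributed_integral[OF D, of "\<lambda>x. x ^ (2 * k)"] has_bochner_integral_integral_eq[OF m]
      by simp
  qed
  have I2: "integrable M (\<lambda>\<omega>. (Z \<omega>)\<^sup>2)" and E2: "expectation (\<lambda>\<omega>. (Z \<omega>)\<^sup>2) = s\<^sup>2"
    using I[of 1] E[of 1] by simp_all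
  have I4: "integrable M (\<lambda>\<omega>. Z \<omega> ^ 4)" and E4: "expectation (\<lambda>\<omega>. Z \<omega> ^ 4) = 3 * s ^ 4"
    using I[of 2] E[of 2] by (simp_all add: fact_numeral power_divide field_simps)
  have eq: "((Z \<omega>)\<^sup>2 - s\<^sup>2)\<^sup>2 = Z \<omega> ^ 4 - 2 * s\<^sup>2 * (Z \<omega>)\<^sup>2 + s ^ 4" for \<omega>
    by (simp add: power2_diff power_mult[symmetric] mult.commute)
  show "integrable M (\<lambda>\<omega>. ((Z \<omega>)\<^sup>2 - s\<^sup>2)\<^sup>2)"
    unfolding eq using I2 I4 by simp
  show "expectation (\<lambda>\<omega>. (Z \<omega>)\<^sup>2 - s\<^sup>2) = 0"
    using I2 E2 by (simp add: prob_space)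
  show "expectation (\<lambda>\<omega>. ((Z \<omega>)\<^sup>2 - s\<^sup>2)\<^sup>2) = 2 * s ^ 4"
    unfolding eq using I2 I4 E2 E4 by (simp add: prob_space power2_eq_square power4_eq_xxxx)
qed

text \<open>
  The squared increments minus their means \<open>t/n\<close> are independent and centred with variance \<open>2 (t/n)\<^sup>2\<close>.
  Their sum has variance \<open>2 t\<^sup>2 / n\<close>, and Chebyshev's inequality applies.
\<close>

lemma wiener_quadratic_variation_deviation:
  assumes w: "wiener_process M w" and "t > 0" "n > 0" "a > 0"
  shows "prob {\<omega> \<in> space M.
      a < \<bar>(\<Sum>i<n. (w (t * real (Suc i) / n) \<omega> - w (t * real i / n) \<omega>)\<^sup>2) - t\<bar>} \<le> 2 * t\<^sup>2 / (n * a\<^sup>2)"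
proof -
  define \<tau> where "\<tau> i = t * real i / n" for i :: nat
  define s where "s = sqrt (t / n)"
  define X where "X i \<omega> = (w (\<tau> (Suc i)) \<omega> - w (\<tau> i) \<omega>)\<^sup>2 - s\<^sup>2" for i \<omega>
  have s: "s > 0" "s\<^sup>2 = t / n" using assms by (simp_all add: s_def)
  have \<tau>: "0 \<le> \<tau> i" "\<tau> i < \<tau> (Suc i)" "\<tau> (Suc i) - \<tau> i = t / n" for i
    using assms by (auto simp: \<tau>_def field_simps)
  have D: "distributed M lborel (\<lambda>\<omega>. w (\<tau> (Suc i)) \<omega> - w (\<tau> i) \<omega>) (normal_density 0 s)" for i
    using w \<tau>[of i] unfolding wiener_process_def s_def by metis
  have "indep_vars (\<lambda>_. borel) (\<lambda>i \<omega>. w (\<tau> (Suc i)) \<omega> - w (\<tau> i) \<omega>) {..<n}"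
    using w \<tau> unfolding wiener_process_def by (meson less_imp_le)
  then have ind: "indep_vars (\<lambda>_. borel) X {..<n}"
    unfolding X_def by (rule indep_vars_compose2) simp
  note mom = normal_square_moments[OF D s(1), folded X_def]
  have sum: "integrable M (\<lambda>\<omega>. (\<Sum>i<n. X i \<omega>)\<^sup>2)"
    "expectation (\<lambda>\<omega>. (\<Sum>i<n. X i \<omega>)\<^sup>2) = n * (2 * s ^ 4)"
    using second_moment_indep_sum[OF _ ind] mom by simp_all
  have rv: "random_variable borel (\<lambda>\<omega>. \<Sum>i<n. X i \<omega>)"
    using ind by (intro borel_measurable_sum) (auto simp: indep_vars_def)
  have intX: "integrable M (X i)" if "i < n" for i
    using square_integrable_imp_integrable[of "X i"] ind mom(1) that by (auto simp: indep_vars_def)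
  have E0: "expectation (\<lambda>\<omega>. \<Sum>i<n. X i \<omega>) = 0"
    using mom(2) intX by simp
  have "prob {\<omega> \<in> space M. a \<le> \<bar>\<Sum>i<n. X i \<omega>\<bar>} \<le> (n * (2 * s ^ 4)) / a\<^sup>2"
    using Chebyshev_inequality[OF rv sum(1) \<open>a > 0\<close>] sum(2) E0 by simp
  also have "s ^ 4 = (t / n)\<^sup>2"
    using s(2) by (metis power_even_eq mult_2 numeral_Bit0 power2_eq_square power4_eq_xxxx mult.assoc)
  finally have le: "prob {\<omega> \<in> space M. a \<le> \<bar>\<Sum>i<n. X i \<omega>\<bar>} \<le> 2 * t\<^sup>2 / (n * a\<^sup>2)"
    using \<open>n > 0\<close> by (simp add: power2_eq_square field_simps)
  have "(\<Sum>i<n. X i \<omega>) = (\<Sum>i<n. (w (\<tau> (Suc i)) \<omega> - w (\<tau> i) \<omega>)\<^sup>2) - t" for \<omega>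
    using s(2) \<open>n > 0\<close> by (simp add: X_def sum_subtractf)
  moreover have "prob {\<omega> \<in> space M. a < \<bar>\<Sum>i<n. X i \<omega>\<bar>} \<le> prob {\<omega> \<in> space M. a \<le> \<bar>\<Sum>i<n. X i \<omega>\<bar>}"
    using rv by (intro finite_measure_mono) auto
  ultimately show ?thesis using le unfolding \<tau>_def by simp
qed

lemma wiener_quadratic_variation_in_prob:
  assumes w: "wiener_process M w" and "t > 0" "e > 0"
  shows "(\<lambda>n. prob {\<omega> \<in> space M.
      e < \<bar>(\<Sum>i<Suc n. (w (t * real (Suc i) / Suc n) \<omega> - w (t * real i / Suc n) \<omega>)\<^sup>2) - t\<bar>}) \<longlonglongrightarrow> 0"
proof (rule tendsto_sandwich[OF _ _ tendsto_const])
  show "(\<lambda>n. 2 * t\<^sup>2 / e\<^sup>2 * inverse (real (Suc n))) \<longlonglongrightarrow> 0"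
    using tendsto_mult_right_zero[OF LIMSEQ_inverse_real_of_nat] by blast
  have "2 * t\<^sup>2 / (real (Suc n) * e\<^sup>2) = 2 * t\<^sup>2 / e\<^sup>2 * inverse (real (Suc n))" for n
    by (simp add: divide_inverse mult_ac)
  then show "eventually (\<lambda>n. prob {\<omega> \<in> space M.
      e < \<bar>(\<Sum>i<Suc n. (w (t * real (Suc i) / Suc n) \<omega> - w (t * real i / Suc n) \<omega>)\<^sup>2) - t\<bar>}
      \<le> 2 * t\<^sup>2 / e\<^sup>2 * inverse (real (Suc n))) sequentially"
    using wiener_quadratic_variation_deviation[OF w \<open>t > 0\<close> zero_less_Suc \<open>e > 0\<close>] by simp
qed simp

end


section \<open>Quadratic variation along a fixed path\<close>

text \<open>
  The cubic Taylor remainder has the coefficient \<open>exp \<xi> / 6\<close> with \<open>\<bar>\<xi>\<bar> \<le> 1\<close>, which is at most \<open>1\<close>.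
\<close>

lemma abs_exp_minus_quadratic_le:
  fixes d :: real
  assumes "\<bar>d\<bar> \<le> 1"
  shows "\<bar>exp d - 1 - d - d\<^sup>2 / 2\<bar> \<le> \<bar>d\<bar> * d\<^sup>2"
proof -
  obtain t where t: "\<bar>t\<bar> \<le> \<bar>d\<bar>" "exp d = (\<Sum>m<3. d ^ m / fact m) + exp t / fact 3 * d ^ 3"
    using Maclaurin_exp_le[of d 3] by blast
  have "exp t \<le> exp 1" using t(1) assms by simp
  then have e: "exp t / 6 \<le> 1" using exp_le by linarith
  have "exp d - 1 - d - d\<^sup>2 / 2 = exp t / 6 * d ^ 3"
    using t(2) by (simp add: eval_nat_numeral)
  then have "\<bar>exp d - 1 - d - d\<^sup>2 / 2\<bar> = \<bar>exp t / 6 * d ^ 3\<bar>" by (rule arg_cong)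
  also have "\<dots> = exp t / 6 * (\<bar>d\<bar> * d\<^sup>2)"
    by (simp add: abs_mult eval_nat_numeral)
  also have "\<dots> \<le> 1 * (\<bar>d\<bar> * d\<^sup>2)" using e by (intro mult_right_mono) auto
  finally show ?thesis by simp
qed

lemma uniform_partition_points:
  assumes "t \<ge> 0" "n > 0"
  shows "partition_points t n (\<lambda>i. t * real i / real n)"
  using assms by (auto simp: partition_points_def divide_right_mono mult_left_mono)

lemma continuous_small_increments:
  fixes x :: "real \<Rightarrow> real" and r :: "nat \<Rightarrow> nat"
  assumes x: "continuous_on {0..} x" and "t \<ge> 0" and r: "filterlim r at_top sequentially" and "e > 0"
  shows "eventually (\<lambda>k. \<forall>i<r k. \<bar>x (t * real (Suc i) / r k) - x (t * real i / r k)\<bar> < e) sequentially"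
proof -
  have "uniformly_continuous_on {0..t} x"
    by (rule compact_uniformly_continuous) (auto intro: continuous_on_subset[OF x])
  then obtain d where d: "d > 0"
    "\<And>u v. u \<in> {0..t} \<Longrightarrow> v \<in> {0..t} \<Longrightarrow> \<bar>v - u\<bar> < d \<Longrightarrow> \<bar>x v - x u\<bar> < e"
    using \<open>e > 0\<close> unfolding uniformly_continuous_on_def dist_real_def by metis
  obtain N :: nat where N: "t / d < N" using reals_Archimedean2 by blast
  have "eventually (\<lambda>k. r k > N) sequentially"
    using eventually_compose_filterlim[OF eventually_gt_at_top r] .
  then show ?thesis
  proof eventually_elim
    case (elim k)
    then have pos: "real (r k) > 0" by simp
    have "t < d * N" using N d(1) by (simp add: field_simps)
    also have "d * N < d * r k" using elim d(1) by simp
    finally have mesh: "t / r k < d" using pos by (simp add: field_simps)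
    show ?case
    proof (intro allI impI)
      fix i assume i: "i < r k"
      have "t * real j / r k \<in> {0..t}" if "j \<le> r k" for j
        using that pos \<open>t \<ge> 0\<close> by (simp add: pos_divide_le_eq mult_left_mono)
      moreover have "t * real (Suc i) / r k - t * real i / r k = t / r k"
        by (simp add: diff_divide_distrib[symmetric] algebra_simps)
      ultimately show "\<bar>x (t * real (Suc i) / r k) - x (t * real i / r k)\<bar> < e"
        using i mesh \<open>t \<ge> 0\<close> pos by (intro d(2)) (auto simp del: of_nat_Suc)
    qed
  qed
qed

text \<open>
  The deterministic core. Suppose that \<open>y - x\<close> increases along the grids and that the squared increments of
  \<open>y\<close> along them have the limit \<open>V\<close>. If all increments of \<open>x\<close> and \<open>y\<close> are at most \<open>e\<close>, then replacing
  \<open>(\<Delta>x)\<^sup>2\<close> by \<open>(\<Delta>y)\<^sup>2\<close> costs at most \<open>2 e\<close> times the increment of \<open>y - x\<close>, and these increments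
  telescope. So the squared increments of \<open>x\<close> have the limit \<open>V\<close> too, and the Taylor bound turns this into
  a limit for the exponential increments.
\<close>

lemma exp_increment_sums_limit:
  fixes x y :: "real \<Rightarrow> real" and r :: "nat \<Rightarrow> nat"
  assumes "t \<ge> 0" and r: "filterlim r at_top sequentially"
    and x: "continuous_on {0..} x" and y: "continuous_on {0..} y"
    and mono: "\<And>k i. y (t * real i / r k) - x (t * real i / r k)
      \<le> y (t * real (Suc i) / r k) - x (t * real (Suc i) / r k)"
    and QV: "(\<lambda>k. \<Sum>i<r k. (y (t * real (Suc i) / r k) - y (t * real i / r k))\<^sup>2) \<longlonglongrightarrow> V"
  shows "(\<lambda>k. \<Sum>i<r k. exp (x (t * real (Suc i) / r k) - x (t * real i / r k)) - 1)
    \<longlonglongrightarrow> x t - x 0 + V / 2"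
proof -
  define A where "A = (\<lambda>s. y s - x s)"
  define dx where "dx k i = x (t * real (Suc i) / r k) - x (t * real i / r k)" for k i
  define dy where "dy k i = y (t * real (Suc i) / r k) - y (t * real i / r k)" for k i
  define dA where "dA k i = A (t * real (Suc i) / r k) - A (t * real i / r k)" for k i
  define T where "T = A t - A 0"
  have dA: "dA k i \<ge> 0" "dx k i = dy k i - dA k i" for k i
    using mono[of i k] by (simp_all add: dA_def dx_def dy_def A_def)
  have tele: "(\<Sum>i<n. z (t * real (Suc i) / n) - z (t * real i / n)) = z t - z 0"
    if "n > 0" for n :: nat and z :: "real \<Rightarrow> real"
    using sum_lessThan_telescope[of "\<lambda>i. z (t * real i / n)" n] that by simp
  define S where "S k = (\<Sum>i<r k. exp (dx k i) - 1 - dx k i)" for k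
  define Q where "Q = (\<lambda>k. \<Sum>i<r k. (dy k i)\<^sup>2)"
  have r_pos: "eventually (\<lambda>k. r k > 0) sequentially"
    using eventually_compose_filterlim[OF eventually_gt_at_top r] .
  have QV: "Q \<longlonglongrightarrow> V" using QV unfolding Q_def dy_def .
  have bound: "eventually (\<lambda>k. \<bar>S k - Q k / 2\<bar> \<le> e * (V + 1 + 3 * T)) sequentially"
    if e: "0 < e" "e \<le> 1" for e
  proof -
    have "eventually (\<lambda>k. Q k < V + 1) sequentially"
      using order_tendstoD(2)[OF QV, of "V + 1"] by simp
    with r_pos continuous_small_increments[OF x \<open>t \<ge> 0\<close> r e(1)]
      continuous_small_increments[OF y \<open>t \<ge> 0\<close> r e(1)]
    show ?thesis
    proof eventually_elim
      case (elim k)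
      have dx: "\<bar>dx k i\<bar> \<le> e" and dy: "\<bar>dy k i\<bar> \<le> e" if "i < r k" for i
        using elim that unfolding dx_def dy_def by auto
      have sum_dA: "(\<Sum>i<r k. dA k i) = T"
        using tele[OF elim(1)] unfolding dA_def T_def .
      have T0: "T \<ge> 0" unfolding sum_dA[symmetric] by (intro sum_nonneg dA)
      have sq: "\<bar>(dx k i)\<^sup>2 - (dy k i)\<^sup>2\<bar> \<le> 2 * e * dA k i" if "i < r k" for i
      proof -
        have "(dx k i)\<^sup>2 - (dy k i)\<^sup>2 = - dA k i * (dx k i + dy k i)"
          by (simp add: dA(2) power2_eq_square algebra_simps)
        then have "\<bar>(dx k i)\<^sup>2 - (dy k i)\<^sup>2\<bar> = dA k i * \<bar>dx k i + dy k i\<bar>"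
          using dA(1) by (simp add: abs_mult)
        also have "\<dots> \<le> dA k i * (2 * e)"
          using dx[OF that] dy[OF that] dA(1) by (intro mult_left_mono) auto
        finally show ?thesis by (simp add: mult.commute)
      qed
      have sum_sq: "\<bar>(\<Sum>i<r k. (dx k i)\<^sup>2) - Q k\<bar> \<le> 2 * e * T"
      proof -
        have "\<bar>(\<Sum>i<r k. (dx k i)\<^sup>2) - Q k\<bar> \<le> (\<Sum>i<r k. \<bar>(dx k i)\<^sup>2 - (dy k i)\<^sup>2\<bar>)"
          unfolding Q_def sum_subtractf[symmetric] by (rule sum_abs)
        also have "\<dots> \<le> (\<Sum>i<r k. 2 * e * dA k i)" by (intro sum_mono sq) auto
        finally show ?thesis by (simp add: sum_distrib_left[symmetric] sum_dA)
      qed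
      have "\<bar>S k - (\<Sum>i<r k. (dx k i)\<^sup>2) / 2\<bar> = \<bar>\<Sum>i<r k. exp (dx k i) - 1 - dx k i - (dx k i)\<^sup>2 / 2\<bar>"
        by (simp add: S_def sum_subtractf sum_divide_distrib)
      also have "\<dots> \<le> (\<Sum>i<r k. \<bar>exp (dx k i) - 1 - dx k i - (dx k i)\<^sup>2 / 2\<bar>)"
        by (rule sum_abs)
      also have "\<dots> \<le> (\<Sum>i<r k. e * (dx k i)\<^sup>2)"
      proof (rule sum_mono)
        fix i assume "i \<in> {..<r k}"
        then have "\<bar>dx k i\<bar> \<le> e" using dx by simp
        then show "\<bar>exp (dx k i) - 1 - dx k i - (dx k i)\<^sup>2 / 2\<bar> \<le> e * (dx k i)\<^sup>2"
          using abs_exp_minus_quadratic_le[of "dx k i"] e(2)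
            mult_right_mono[of "\<bar>dx k i\<bar>" e "(dx k i)\<^sup>2"] by simp
      qed
      also have "\<dots> = e * (\<Sum>i<r k. (dx k i)\<^sup>2)" by (simp add: sum_distrib_left)
      also have "\<dots> \<le> e * (V + 1 + 2 * T)"
      proof (rule mult_left_mono)
        have "2 * e * T \<le> 2 * T" using e(2) T0 mult_right_mono[of e 1 T] by simp
        then show "(\<Sum>i<r k. (dx k i)\<^sup>2) \<le> V + 1 + 2 * T" using sum_sq elim by linarith
      qed (use e in simp)
      finally have "\<bar>S k - (\<Sum>i<r k. (dx k i)\<^sup>2) / 2\<bar> \<le> e * (V + 1 + 2 * T)" .
      then have "\<bar>S k - Q k / 2\<bar> \<le> e * (V + 1 + 2 * T) + e * T"
        using sum_sq by linarith
      then show ?case by (simp add: algebra_simps)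
    qed
  qed
  have "(\<lambda>k. S k - Q k / 2) \<longlonglongrightarrow> 0"
  proof (rule tendstoI)
    fix c :: real assume "c > 0"
    define C where "C = \<bar>V + 1 + 3 * T\<bar> + 1"
    define e where "e = min 1 (c / (2 * C))"
    have C: "C > 0" by (simp add: C_def)
    have e: "0 < e" "e \<le> 1" using \<open>c > 0\<close> C by (simp_all add: e_def)
    have "e * (V + 1 + 3 * T) \<le> e * C" using e by (intro mult_left_mono) (auto simp: C_def)
    also have "\<dots> \<le> c / (2 * C) * C" using C by (intro mult_right_mono) (auto simp: e_def)
    also have "\<dots> < c" using C \<open>c > 0\<close> by simp
    finally have le: "e * (V + 1 + 3 * T) < c" .
    show "eventually (\<lambda>k. dist (S k - Q k / 2) 0 < c) sequentially"
      using bound[OF e] by eventually_elim (use le in simp)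
  qed
  from tendsto_add[OF this tendsto_divide[OF QV tendsto_const, of 2]]
  have "S \<longlonglongrightarrow> V / 2" by simp
  then have lim: "(\<lambda>k. x t - x 0 + S k) \<longlonglongrightarrow> x t - x 0 + V / 2"
    by (intro tendsto_intros)
  have "eventually (\<lambda>k. x t - x 0 + S k = (\<Sum>i<r k. exp (dx k i) - 1)) sequentially"
    using r_pos
  proof eventually_elim
    case (elim k)
    have "(\<Sum>i<r k. dx k i) = x t - x 0" using tele[OF elim] unfolding dx_def .
    then show ?case by (simp add: S_def sum_subtractf)
  qed
  from Lim_transform_eventually[OF lim this] show ?thesis unfolding dx_def .
qed

text \<open>
  A linear drift does not change quadratic variation up to scaling: its squares sum to a term of order
  \<open>1/n\<close>, and because the grid is uniform the cross terms telescope to a term of the same order.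
\<close>

lemma drifted_square_increments_limit:
  fixes v :: "real \<Rightarrow> real" and r :: "nat \<Rightarrow> nat"
  assumes r: "filterlim r at_top sequentially"
    and QV: "(\<lambda>k. \<Sum>i<r k. (v (t * real (Suc i) / r k) - v (t * real i / r k))\<^sup>2) \<longlonglongrightarrow> V"
  shows "(\<lambda>k. \<Sum>i<r k. ((\<mu> * (t * real (Suc i) / r k) + \<sigma> * v (t * real (Suc i) / r k))
      - (\<mu> * (t * real i / r k) + \<sigma> * v (t * real i / r k)))\<^sup>2) \<longlonglongrightarrow> \<sigma>\<^sup>2 * V"
proof -
  define dv where "dv k i = v (t * real (Suc i) / r k) - v (t * real i / r k)" for k i
  have r_pos: "eventually (\<lambda>k. r k > 0) sequentially"
    using eventually_compose_filterlim[OF eventually_gt_at_top r] .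
  have inv: "(\<lambda>k. inverse (real (r k))) \<longlonglongrightarrow> 0"
    using filterlim_compose[OF filterlim_real_sequentially r] by (rule tendsto_inverse_0_at_top)
  have "(\<lambda>k. ((\<mu> * t)\<^sup>2 + 2 * (\<mu> * t) * \<sigma> * (v t - v 0)) * inverse (real (r k))
      + \<sigma>\<^sup>2 * (\<Sum>i<r k. (dv k i)\<^sup>2))
    \<longlonglongrightarrow> ((\<mu> * t)\<^sup>2 + 2 * (\<mu> * t) * \<sigma> * (v t - v 0)) * 0 + \<sigma>\<^sup>2 * V"
    using QV unfolding dv_def by (intro tendsto_intros inv)
  then have lim: "(\<lambda>k. ((\<mu> * t)\<^sup>2 + 2 * (\<mu> * t) * \<sigma> * (v t - v 0)) * inverse (real (r k))
      + \<sigma>\<^sup>2 * (\<Sum>i<r k. (dv k i)\<^sup>2)) \<longlonglongrightarrow> \<sigma>\<^sup>2 * V" by simp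
  have "eventually (\<lambda>k. ((\<mu> * t)\<^sup>2 + 2 * (\<mu> * t) * \<sigma> * (v t - v 0)) * inverse (real (r k))
      + \<sigma>\<^sup>2 * (\<Sum>i<r k. (dv k i)\<^sup>2)
    = (\<Sum>i<r k. ((\<mu> * (t * real (Suc i) / r k) + \<sigma> * v (t * real (Suc i) / r k))
      - (\<mu> * (t * real i / r k) + \<sigma> * v (t * real i / r k)))\<^sup>2)) sequentially"
    using r_pos
  proof eventually_elim
    case (elim k)
    define c where "c = \<mu> * t * inverse (real (r k))"
    have tele: "(\<Sum>i<r k. dv k i) = v t - v 0"
      using sum_lessThan_telescope[of "\<lambda>i. v (t * real i / r k)" "r k"] elim by (simp add: dv_def)
    have "(\<mu> * (t * real (Suc i) / r k) + \<sigma> * v (t * real (Suc i) / r k))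
      - (\<mu> * (t * real i / r k) + \<sigma> * v (t * real i / r k)) = c + \<sigma> * dv k i" for i
      by (simp add: c_def dv_def divide_inverse algebra_simps)
    then have "(\<Sum>i<r k. ((\<mu> * (t * real (Suc i) / r k) + \<sigma> * v (t * real (Suc i) / r k))
      - (\<mu> * (t * real i / r k) + \<sigma> * v (t * real i / r k)))\<^sup>2)
      = (\<Sum>i<r k. c\<^sup>2 + 2 * c * \<sigma> * dv k i + \<sigma>\<^sup>2 * (dv k i)\<^sup>2)"
      by (simp add: power2_sum power_mult_distrib mult_ac add_ac)
    also have "\<dots> = r k * c\<^sup>2 + 2 * c * \<sigma> * (v t - v 0) + \<sigma>\<^sup>2 * (\<Sum>i<r k. (dv k i)\<^sup>2)"
      by (simp add: sum.distrib sum_distrib_left[symmetric] tele)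
    also have "r k * c\<^sup>2 = (\<mu> * t)\<^sup>2 * inverse (real (r k))"
      using elim by (simp add: c_def power2_eq_square)
    finally show ?case by (simp add: c_def algebra_simps)
  qed
  from Lim_transform_eventually[OF lim this] show ?thesis .
qed


section \<open>Solution of the price equation\<close>

context prob_space
begin

text \<open>
  Convergence in probability gives almost sure convergence along a subsequence chosen so that the
  deviations by more than \<open>2\<^sup>-\<^sup>k\<close> have summable probabilities (Borel-Cantelli).
\<close>

lemma AE_tendsto_subsequence:
  fixes U :: "nat \<Rightarrow> 'a \<Rightarrow> real"
  assumes [measurable]: "\<And>n. random_variable borel (U n)" "random_variable borel I"
    and lim: "\<And>e. e > 0 \<Longrightarrow> (\<lambda>n. prob {\<omega> \<in> space M. e < \<bar>U n \<omega> - I \<omega>\<bar>}) \<longlonglongrightarrow> 0"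
  obtains r :: "nat \<Rightarrow> nat" where "strict_mono r" "AE \<omega> in M. (\<lambda>k. U (r k) \<omega>) \<longlonglongrightarrow> I \<omega>"
proof -
  define A where "A k n = {\<omega> \<in> space M. (1 / 2) ^ k < \<bar>U n \<omega> - I \<omega>\<bar>}" for k n :: nat
  have A[measurable]: "A k n \<in> events" for k n unfolding A_def by measurable
  have "\<exists>n>m. prob (A k n) < (1 / 2) ^ k" for k m
  proof -
    have "eventually (\<lambda>n. prob (A k n) < (1 / 2) ^ k) sequentially"
      using order_tendstoD(2)[OF lim[of "(1 / 2) ^ k"], of "(1 / 2) ^ k"] by (simp add: A_def)
    then have "eventually (\<lambda>n. n > m \<and> prob (A k n) < (1 / 2) ^ k) sequentially"
      using eventually_gt_at_top by eventually_elim auto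
    then show ?thesis by (auto simp: eventually_sequentially)
  qed
  then have "\<exists>r. \<forall>k. prob (A k (r k)) < (1 / 2) ^ k \<and> r k < r (Suc k)"
    using dependent_nat_choice[where P = "\<lambda>k n. prob (A k n) < (1 / 2) ^ k" and Q = "\<lambda>_. (<)"]
    by metis
  then obtain r where r: "\<And>k. prob (A k (r k)) < (1 / 2) ^ k" "\<And>k. r k < r (Suc k)"
    by blast
  have "summable (\<lambda>k. prob (A k (r k)))"
    by (rule summable_comparison_test'[of "\<lambda>k. (1 / 2) ^ k" 0])
       (use r(1) in \<open>auto intro: less_imp_le\<close>)
  then have "AE \<omega> in M. eventually (\<lambda>k. \<omega> \<in> space M - A k (r k)) sequentially"
    by (intro borel_cantelli_AE1) (auto simp: emeasure_eq_measure)
  then have "AE \<omega> in M. (\<lambda>k. U (r k) \<omega>) \<longlonglongrightarrow> I \<omega>"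
  proof eventually_elim
    case (elim \<omega>)
    then have "eventually (\<lambda>k. norm (U (r k) \<omega> - I \<omega>) \<le> (1 / 2) ^ k) sequentially"
      by eventually_elim (auto simp: A_def not_less)
    moreover have "(\<lambda>k. (1 / 2 :: real) ^ k) \<longlonglongrightarrow> 0" by (rule LIMSEQ_power_zero) simp
    ultimately show ?case by (metis Lim_null_comparison LIM_zero_cancel)
  qed
  moreover have "strict_mono r" using r(2) by (simp add: strict_mono_Suc_iff)
  ultimately show thesis by (rule that[rotated])
qed

lemma ito_integral_uniform_sums_in_prob:
  assumes "has_ito_integral M X Y t I" and "t \<ge> 0" "e > 0"
  shows "(\<lambda>n. prob {\<omega> \<in> space M.
      e < \<bar>(\<Sum>i<Suc n. X (t * real i / Suc n) \<omega>
        * (Y (t * real (Suc i) / Suc n) \<omega> - Y (t * real i / Suc n) \<omega>)) - I \<omega>\<bar>}) \<longlonglongrightarrow> 0"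
proof (rule LIMSEQ_I)
  fix \<eta> :: real assume "\<eta> > 0"
  then obtain \<delta> where \<delta>: "\<delta> > 0"
    "\<And>n \<tau>. partition_points t n \<tau> \<Longrightarrow> (\<And>i. i < n \<Longrightarrow> \<tau> (Suc i) - \<tau> i < \<delta>) \<Longrightarrow>
      prob {\<omega> \<in> space M. e < \<bar>(\<Sum>i<n. X (\<tau> i) \<omega> * (Y (\<tau> (Suc i)) \<omega> - Y (\<tau> i) \<omega>)) - I \<omega>\<bar>} < \<eta>"
    using assms(1)[unfolded has_ito_integral_def, rule_format, OF \<open>e > 0\<close>, of \<eta>] by blast
  obtain N :: nat where N: "t / \<delta> < N" using reals_Archimedean2 by blast
  have "t * real (Suc i) / Suc n - t * real i / Suc n < \<delta>" if "n \<ge> N" for n i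
  proof -
    have "t < \<delta> * N" using N \<delta>(1) by (simp add: field_simps)
    also have "\<delta> * N \<le> \<delta> * Suc n" using that \<delta>(1) by simp
    finally have "t / Suc n < \<delta>" by (simp add: pos_divide_less_eq)
    moreover have "t * real (Suc i) / Suc n - t * real i / Suc n = t / Suc n"
      by (simp add: diff_divide_distrib[symmetric] algebra_simps)
    ultimately show ?thesis by simp
  qed
  from \<delta>(2)[OF uniform_partition_points[OF \<open>t \<ge> 0\<close>] this]
  show "\<exists>N. \<forall>n\<ge>N. norm (prob {\<omega> \<in> space M.
      e < \<bar>(\<Sum>i<Suc n. X (t * real i / Suc n) \<omega>
        * (Y (t * real (Suc i) / Suc n) \<omega> - Y (t * real i / Suc n) \<omega>)) - I \<omega>\<bar>} - 0) < \<eta>"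
    by (intro exI[of _ N]) simp
qed

text \<open>
  The Ito sum over \<open>[s,t]\<close> dominates the increment of \<open>ln b\<close> term by term, because
  \<open>ln z \<le> z - 1\<close>. It is the difference of two Ito sums that start at \<open>0\<close>, along a partition of \<open>[0,t]\<close>
  that passes through \<open>s\<close>. Each of them is within \<open>e/2\<close> of its limit outside an event of probability
  \<open>\<eta>/2\<close>.
\<close>

lemma log_increment_le_ito_increment_except:
  assumes p: "price_process M \<mu> \<sigma> w b" and w: "wiener_process M w"
    and "0 \<le> s" "s < t" "e > 0" "\<eta> > 0"
  shows "prob {\<omega> \<in> space M. \<mu> * t + \<sigma> * w t \<omega> - (\<mu> * s + \<sigma> * w s \<omega>) + e < ln (b t \<omega>) - ln (b s \<omega>)} \<le> \<eta>"
    (is "prob ?D \<le> \<eta>")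
proof -
  define I where "I u \<omega> = \<mu> * u + \<sigma> * w u \<omega>" for u \<omega>
  have bm[measurable]: "b u \<in> borel_measurable M" if "u \<ge> 0" for u
    using p that unfolding price_process_def by auto
  have wm[measurable]: "w u \<in> borel_measurable M" if "u \<ge> 0" for u
    using w that unfolding wiener_process_def by auto
  have pos: "AE \<omega> in M. \<forall>u\<ge>0. b u \<omega> > 0" using p unfolding price_process_def by auto
  define Sum where "Sum \<tau> n \<omega> = (\<Sum>i<n. 1 / b (\<tau> i) \<omega> * (b (\<tau> (Suc i)) \<omega> - b (\<tau> i) \<omega>))"
    for \<tau> :: "nat \<Rightarrow> real" and n \<omega>
  have ito: "\<exists>\<delta>>0. \<forall>n \<tau>. partition_points u n \<tau> \<and> (\<forall>i<n. \<tau> (Suc i) - \<tau> i < \<delta>) \<longrightarrow>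
      prob {\<omega> \<in> space M. e / 2 < \<bar>Sum \<tau> n \<omega> - I u \<omega>\<bar>} < \<eta> / 2" if "u \<ge> 0" for u
  proof -
    have "has_ito_integral M (\<lambda>s \<omega>. 1 / b s \<omega>) b u (I u)"
      using p that unfolding price_process_def I_def by blast
    moreover have "e / 2 > 0" "\<eta> / 2 > 0" using assms by auto
    ultimately show ?thesis unfolding has_ito_integral_def Sum_def by blast
  qed
  obtain d1 where d1: "d1 > 0" "\<And>n \<tau>. partition_points s n \<tau> \<Longrightarrow> \<forall>i<n. \<tau> (Suc i) - \<tau> i < d1 \<Longrightarrow>
      prob {\<omega> \<in> space M. e / 2 < \<bar>Sum \<tau> n \<omega> - I s \<omega>\<bar>} < \<eta> / 2"
    using ito[OF \<open>0 \<le> s\<close>] by blast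
  have "t \<ge> 0" using assms by simp
  obtain d2 where d2: "d2 > 0" "\<And>n \<tau>. partition_points t n \<tau> \<Longrightarrow> \<forall>i<n. \<tau> (Suc i) - \<tau> i < d2 \<Longrightarrow>
      prob {\<omega> \<in> space M. e / 2 < \<bar>Sum \<tau> n \<omega> - I t \<omega>\<bar>} < \<eta> / 2"
    using ito[OF \<open>t \<ge> 0\<close>] by blast
  define d where "d = min d1 d2"
  have "d > 0" using d1 d2 by (simp add: d_def)
  obtain n :: nat where n: "t / d < n" using reals_Archimedean2 by blast
  have "0 < t" using assms by simp
  then have "0 < t / d" using \<open>d > 0\<close> by simp
  then have n0: "real n > 0" using n by linarith
  then have n0': "n > 0" by simp
  \<comment> \<open>Both \<open>[0,s]\<close> and \<open>[s,t]\<close> are cut into \<open>n\<close> equal parts, so the first \<open>n\<close> steps partition \<open>[0,s]\<close>.\<close>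
  define \<tau> where "\<tau> i = (if i \<le> n then s * real i / n else s + (t - s) * (real i - n) / n)" for i
  have step: "0 \<le> \<tau> (Suc i) - \<tau> i \<and> \<tau> (Suc i) - \<tau> i < d" for i
  proof -
    have td: "t / n < d" using n n0 \<open>d > 0\<close> by (simp add: field_simps)
    consider "i < n" | "i = n" | "i > n" by linarith
    then have "\<tau> (Suc i) - \<tau> i = s / n \<or> \<tau> (Suc i) - \<tau> i = (t - s) / n"
      using n0 by cases (simp_all add: \<tau>_def field_simps)
    moreover have "0 \<le> s / n" "s / n \<le> t / n" "0 \<le> (t - s) / n" "(t - s) / n \<le> t / n"
      using assms n0 by (auto intro!: divide_right_mono)
    ultimately show ?thesis using td by auto
  qed
  have ends: "\<tau> 0 = 0" "\<tau> n = s" "\<tau> (n + n) = t"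
    using n0 n0' by (simp_all add: \<tau>_def)
  have \<tau>: "partition_points s n \<tau>" "partition_points t (n + n) \<tau>"
    using step ends by (simp_all add: partition_points_def)
  have \<tau>0: "\<tau> i \<ge> 0" for i
    using assms n0 by (auto simp: \<tau>_def intro!: add_nonneg_nonneg divide_nonneg_nonneg mult_nonneg_nonneg)
  have Im[measurable]: "I u \<in> borel_measurable M" if "u \<ge> 0" for u
    unfolding I_def using that by measurable
  have Sm[measurable]: "Sum \<tau> m \<in> borel_measurable M" for m
    unfolding Sum_def using bm[OF \<tau>0] by measurable
  define E1 where "E1 = {\<omega> \<in> space M. e / 2 < \<bar>Sum \<tau> n \<omega> - I s \<omega>\<bar>}"
  define E2 where "E2 = {\<omega> \<in> space M. e / 2 < \<bar>Sum \<tau> (n + n) \<omega> - I t \<omega>\<bar>}"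
  have E[measurable]: "E1 \<in> events" "E2 \<in> events"
    unfolding E1_def E2_def using Im[OF \<open>0 \<le> s\<close>] Im[OF \<open>t \<ge> 0\<close>] by measurable
  have "prob E1 < \<eta> / 2" "prob E2 < \<eta> / 2"
    unfolding E1_def E2_def using step d1(2)[OF \<tau>(1)] d2(2)[OF \<tau>(2)] by (metis d_def min_less_iff_conj)+
  moreover have "prob (E1 \<union> E2) \<le> prob E1 + prob E2"
    by (rule measure_Un_le) (use E in auto)
  moreover have "prob ?D \<le> prob (E1 \<union> E2)"
  proof (rule finite_measure_mono_AE)
    show "AE \<omega> in M. \<omega> \<in> ?D \<longrightarrow> \<omega> \<in> E1 \<union> E2"
      using pos
    proof eventually_elim
      case (elim \<omega>)
      have bp: "b (\<tau> i) \<omega> > 0" for i using elim \<tau>0 by blast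
      have split: "Sum \<tau> (n + m) \<omega> = Sum \<tau> n \<omega>
          + (\<Sum>i<m. 1 / b (\<tau> (n + i)) \<omega> * (b (\<tau> (Suc (n + i))) \<omega> - b (\<tau> (n + i)) \<omega>))" for m
        by (induction m) (simp_all add: Sum_def)
      have "ln (b t \<omega>) - ln (b s \<omega>) = (\<Sum>i<n. ln (b (\<tau> (n + Suc i)) \<omega>) - ln (b (\<tau> (n + i)) \<omega>))"
        using sum_lessThan_telescope[of "\<lambda>i. ln (b (\<tau> (n + i)) \<omega>)" n] ends by simp
      also have "\<dots> \<le> (\<Sum>i<n. 1 / b (\<tau> (n + i)) \<omega> * (b (\<tau> (Suc (n + i))) \<omega> - b (\<tau> (n + i)) \<omega>))"
      proof (rule sum_mono)
        fix i
        have "ln (b (\<tau> (n + Suc i)) \<omega>) - ln (b (\<tau> (n + i)) \<omega>)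
          = ln (b (\<tau> (n + Suc i)) \<omega> / b (\<tau> (n + i)) \<omega>)"
          using bp[of "n + Suc i"] bp[of "n + i"] by (simp add: ln_div del: add_Suc_right)
        also have "\<dots> \<le> b (\<tau> (n + Suc i)) \<omega> / b (\<tau> (n + i)) \<omega> - 1"
          using bp by (intro ln_le_minus_one) (simp del: add_Suc_right)
        also have "\<dots> = 1 / b (\<tau> (n + i)) \<omega> * (b (\<tau> (Suc (n + i))) \<omega> - b (\<tau> (n + i)) \<omega>)"
          using bp[of "n + i"] by (simp add: field_simps)
        finally show "ln (b (\<tau> (n + Suc i)) \<omega>) - ln (b (\<tau> (n + i)) \<omega>) \<le> \<dots>" .
      qed
      also have "\<dots> = Sum \<tau> (n + n) \<omega> - Sum \<tau> n \<omega>"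
        using split[of n] by simp
      finally have "ln (b t \<omega>) - ln (b s \<omega>) \<le> Sum \<tau> (n + n) \<omega> - Sum \<tau> n \<omega>" .
      moreover have "\<bar>Sum \<tau> n \<omega> - I s \<omega>\<bar> \<le> e / 2" "\<bar>Sum \<tau> (n + n) \<omega> - I t \<omega>\<bar> \<le> e / 2"
        if "\<omega> \<in> space M" "\<omega> \<notin> E1 \<union> E2"
        using that by (auto simp: E1_def E2_def)
      ultimately have "ln (b t \<omega>) - ln (b s \<omega>) \<le> I t \<omega> - I s \<omega> + e"
        if "\<omega> \<in> space M" "\<omega> \<notin> E1 \<union> E2"
        using that by linarith
      then show ?case unfolding I_def by force
    qed
  qed (use E in auto)
  ultimately show ?thesis by linarith
qed

lemma log_increment_le_ito_increment:
  assumes p: "price_process M \<mu> \<sigma> w b" and w: "wiener_process M w" and "0 \<le> s" "s < t"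
  shows "AE \<omega> in M. \<mu> * s + \<sigma> * w s \<omega> - ln (b s \<omega>) \<le> \<mu> * t + \<sigma> * w t \<omega> - ln (b t \<omega>)"
proof -
  have t: "t \<ge> 0" using assms by simp
  have [measurable]: "b s \<in> borel_measurable M" "b t \<in> borel_measurable M"
    "w s \<in> borel_measurable M" "w t \<in> borel_measurable M"
    using p w \<open>0 \<le> s\<close> t unfolding price_process_def wiener_process_def by auto
  let ?D = "\<lambda>e. {\<omega> \<in> space M. \<mu> * t + \<sigma> * w t \<omega> - (\<mu> * s + \<sigma> * w s \<omega>) + e < ln (b t \<omega>) - ln (b s \<omega>)}"
  have "AE \<omega> in M. \<omega> \<notin> ?D e" if "e > 0" for e
  proof -
    have "prob (?D e) \<le> 0"
      by (rule field_le_epsilon)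
         (use log_increment_le_ito_increment_except[OF p w assms(3,4) that] in simp)
    then have "prob (?D e) = 0" by (simp add: measure_le_0_iff)
    moreover have "?D e \<in> events" by measurable
    ultimately show ?thesis using prob_eq_0 by blast
  qed
  then have "AE \<omega> in M. \<forall>m::nat. \<omega> \<notin> ?D (inverse (real (Suc m)))"
    unfolding AE_all_countable by simp
  then show ?thesis
    using AE_space
  proof eventually_elim
    case (elim \<omega>)
    show ?case
    proof (rule field_le_epsilon)
      fix e :: real assume "e > 0"
      then obtain m where "inverse (real (Suc m)) < e" using reals_Archimedean by blast
      moreover have "ln (b t \<omega>) - ln (b s \<omega>)
        \<le> \<mu> * t + \<sigma> * w t \<omega> - (\<mu> * s + \<sigma> * w s \<omega>) + inverse (real (Suc m))"
        using elim by (simp add: not_less)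
      ultimately show "\<mu> * s + \<sigma> * w s \<omega> - ln (b s \<omega>) \<le> \<mu> * t + \<sigma> * w t \<omega> - ln (b t \<omega>) + e"
        by linarith
    qed
  qed
qed

text \<open>
  Along a common subsequence of uniform grids almost every path has convergent Ito sums and convergent
  squared increments of \<open>w\<close>, and \<open>y - ln b\<close> is monotone on the countably many grid points. The limit of
  the Ito sums then has two expressions: \<open>\<mu> t + \<sigma> w t\<close> by the price equation and
  \<open>ln (b t) - ln (b 0) + \<sigma>\<^sup>2 t / 2\<close> by the pathwise computation.
\<close>

lemma log_price_eq:
  assumes p: "price_process M \<mu> \<sigma> w b" and w: "wiener_process M w" and "t > 0"
  shows "AE \<omega> in M. ln (b t \<omega>) = (\<mu> - \<sigma>\<^sup>2 / 2) * t + \<sigma> * w t \<omega>"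
proof -
  have t: "t \<ge> 0" using \<open>t > 0\<close> by simp
  have grid0: "0 \<le> t * real i / n" for i n :: nat using t by simp
  have bm: "b u \<in> borel_measurable M" and wm: "w u \<in> borel_measurable M" if "u \<ge> 0" for u
    using p w that unfolding price_process_def wiener_process_def by auto
  note [measurable] = bm[OF grid0] wm[OF grid0] wm[OF t]
  define U where "U n \<omega> = (\<Sum>i<Suc n. 1 / b (t * real i / Suc n) \<omega>
        * (b (t * real (Suc i) / Suc n) \<omega> - b (t * real i / Suc n) \<omega>))" for n \<omega>
  define I where "I \<omega> = \<mu> * t + \<sigma> * w t \<omega>" for \<omega>
  define W where "W n \<omega> = (\<Sum>i<Suc n. (w (t * real (Suc i) / Suc n) \<omega> - w (t * real i / Suc n) \<omega>)\<^sup>2)" for n \<omega>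
  have [measurable]: "U n \<in> borel_measurable M" "W n \<in> borel_measurable M" for n
    unfolding U_def W_def by measurable
  have [measurable]: "I \<in> borel_measurable M" unfolding I_def by measurable
  have "has_ito_integral M (\<lambda>s \<omega>. 1 / b s \<omega>) b t I"
    using p t unfolding price_process_def I_def by blast
  note Ulim = ito_integral_uniform_sums_in_prob[OF this t, folded U_def]
  obtain r1 :: "nat \<Rightarrow> nat" where r1: "strict_mono r1" "AE \<omega> in M. (\<lambda>k. U (r1 k) \<omega>) \<longlonglongrightarrow> I \<omega>"
    by (rule AE_tendsto_subsequence[of U I]) (use Ulim in auto)
  have Wlim: "(\<lambda>k. prob {\<omega> \<in> space M. e < \<bar>W (r1 k) \<omega> - t\<bar>}) \<longlonglongrightarrow> 0" if "e > 0" for e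
    using LIMSEQ_subseq_LIMSEQ[OF wiener_quadratic_variation_in_prob[OF w \<open>t > 0\<close> that, folded W_def] r1(1)]
    by (simp add: o_def)
  obtain r2 :: "nat \<Rightarrow> nat" where r2: "strict_mono r2" "AE \<omega> in M. (\<lambda>k. W (r1 (r2 k)) \<omega>) \<longlonglongrightarrow> t"
    by (rule AE_tendsto_subsequence[of "\<lambda>k. W (r1 k)" "\<lambda>_. t"]) (use Wlim in auto)
  define r where "r k = Suc (r1 (r2 k))" for k
  have r: "filterlim r at_top sequentially"
    using filterlim_subseq[OF strict_mono_o[OF r1(1) r2(1)]]
    unfolding r_def o_def by (rule filterlim_compose[OF filterlim_Suc])
  have mono: "AE \<omega> in M. \<forall>k i. \<mu> * (t * real i / r k) + \<sigma> * w (t * real i / r k) \<omega> - ln (b (t * real i / r k) \<omega>)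
      \<le> \<mu> * (t * real (Suc i) / r k) + \<sigma> * w (t * real (Suc i) / r k) \<omega> - ln (b (t * real (Suc i) / r k) \<omega>)"
    unfolding AE_all_countable
  proof (intro allI log_increment_le_ito_increment[OF p w grid0])
    show "t * real i / real (r k) < t * real (Suc i) / real (r k)" for k i
      using \<open>t > 0\<close> by (auto simp: r_def intro!: divide_strict_right_mono)
  qed
  have "AE \<omega> in M. b 0 \<omega> = 1" "AE \<omega> in M. \<forall>t\<ge>0. b t \<omega> > 0"
    "AE \<omega> in M. continuous_on {0..} (\<lambda>t. b t \<omega>)" "AE \<omega> in M. continuous_on {0..} (\<lambda>t. w t \<omega>)"
    using p w unfolding price_process_def wiener_process_def by auto
  with r1(2) r2(2) mono show ?thesis
  proof eventually_elim
    case (elim \<omega>)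
    define x where "x s = ln (b s \<omega>)" for s
    define y where "y s = \<mu> * s + \<sigma> * w s \<omega>" for s
    have "continuous_on {0..} x"
      unfolding x_def using elim by (intro continuous_intros) force+
    moreover have "continuous_on {0..} y"
      unfolding y_def using elim by (intro continuous_intros)
    moreover have "y (t * real i / r k) - x (t * real i / r k)
      \<le> y (t * real (Suc i) / r k) - x (t * real (Suc i) / r k)" for k i
      using elim unfolding x_def y_def by blast
    moreover have "(\<lambda>k. \<Sum>i<r k. (y (t * real (Suc i) / r k) - y (t * real i / r k))\<^sup>2) \<longlonglongrightarrow> \<sigma>\<^sup>2 * t"
      unfolding y_def
      by (rule drifted_square_increments_limit[OF r]) (use elim in \<open>simp add: W_def r_def\<close>)
    ultimately have lim: "(\<lambda>k. \<Sum>i<r k. exp (x (t * real (Suc i) / r k) - x (t * real i / r k)) - 1)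
      \<longlonglongrightarrow> x t - x 0 + \<sigma>\<^sup>2 * t / 2"
      by (intro exp_increment_sums_limit[OF t r])
    have eqU: "(\<Sum>i<r k. exp (x (t * real (Suc i) / r k) - x (t * real i / r k)) - 1)
      = U (r1 (r2 k)) \<omega>" for k
    proof -
      have "exp (x (t * real (Suc i) / r k) - x (t * real i / r k)) - 1
        = 1 / b (t * real i / r k) \<omega> * (b (t * real (Suc i) / r k) \<omega> - b (t * real i / r k) \<omega>)" for i
      proof -
        have "b (t * real i / r k) \<omega> > 0" "b (t * real (Suc i) / r k) \<omega> > 0"
          using elim grid0 by blast+
        then show ?thesis unfolding x_def exp_diff by (simp add: field_simps)
      qed
      then show ?thesis by (simp add: U_def r_def)
    qed
    have "(\<lambda>k. U (r1 (r2 k)) \<omega>) \<longlonglongrightarrow> I \<omega>"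
      using LIMSEQ_subseq_LIMSEQ[OF elim(1) r2(1)] by (simp add: o_def)
    with lim have "x t - x 0 + \<sigma>\<^sup>2 * t / 2 = I \<omega>"
      unfolding eqU by (rule LIMSEQ_unique)
    moreover have "x 0 = 0" using elim by (simp add: x_def)
    ultimately show ?case by (simp add: x_def I_def algebra_simps)
  qed
qed

lemma wiener_increment_from_start:
  assumes "wiener_process M w" and "t > 0"
  shows "distributed M lborel (\<lambda>\<omega>. w t \<omega> - w 0 \<omega>) (normal_density 0 (sqrt t))"
proof -
  have "\<forall>s t. 0 \<le> s \<and> s < t \<longrightarrow>
      distributed M lborel (\<lambda>\<omega>. w t \<omega> - w s \<omega>) (normal_density 0 (sqrt (t - s)))"
    using assms(1) unfolding wiener_process_def by blast
  from this[rule_format, of 0 t] \<open>t > 0\<close> show ?thesis by simp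
qed

lemma price_eq_lognormal:
  assumes p: "price_process M \<mu> \<sigma> w b" and w: "wiener_process M w" and "t > 0"
  shows "AE \<omega> in M. b t \<omega> = exp ((\<mu> - \<sigma>\<^sup>2 / 2) * t + \<sigma> * (w t \<omega> - w 0 \<omega>))"
proof -
  have "AE \<omega> in M. w 0 \<omega> = 0" "AE \<omega> in M. \<forall>u\<ge>0. b u \<omega> > 0"
    using p w unfolding price_process_def wiener_process_def by auto
  with log_price_eq[OF p w \<open>t > 0\<close>] show ?thesis
  proof eventually_elim
    case (elim \<omega>)
    then have "0 < b t \<omega>" using \<open>t > 0\<close> by simp
    then have "b t \<omega> = exp (ln (b t \<omega>))" by simp
    also have "ln (b t \<omega>) = (\<mu> - \<sigma>\<^sup>2 / 2) * t + \<sigma> * (w t \<omega> - w 0 \<omega>)" using elim by simp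
    finally show ?case .
  qed
qed

text \<open>
  Weighting the centred normal density by the price gives a multiple of a normal density with shifted
  mean.
\<close>

lemma price_has_mean_exp_drift:
  assumes p: "price_process M \<mu> \<sigma> w b" and w: "wiener_process M w" and "t > 0"
  shows "integrable M (b t)" and "expectation (b t) = exp (\<mu> * t)"
proof -
  define g where "g z = exp ((\<mu> - \<sigma>\<^sup>2 / 2) * t + \<sigma> * z)" for z
  define Z where "Z \<omega> = w t \<omega> - w 0 \<omega>" for \<omega>
  have [measurable]: "g \<in> borel_measurable borel" unfolding g_def by measurable
  have bm[measurable]: "b t \<in> borel_measurable M"
    and wm[measurable]: "w t \<in> borel_measurable M" "w 0 \<in> borel_measurable M"
    using p w \<open>t > 0\<close> unfolding price_process_def wiener_process_def by auto
  have Zm[measurable]: "Z \<in> borel_measurable M" unfolding Z_def by measurable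
  have D: "distributed M lborel Z (normal_density 0 (sqrt t))"
    unfolding Z_def by (rule wiener_increment_from_start[OF w \<open>t > 0\<close>])
  have tilt: "normal_density 0 (sqrt t) z * g z = exp (\<mu> * t) * normal_density (\<sigma> * t) (sqrt t) z" for z
  proof -
    have "- z\<^sup>2 / (2 * t) + ((\<mu> - \<sigma>\<^sup>2 / 2) * t + \<sigma> * z) = \<mu> * t + - (z - \<sigma> * t)\<^sup>2 / (2 * t)"
      using \<open>t > 0\<close> by (simp add: power2_eq_square field_simps)
    then show ?thesis
      using \<open>t > 0\<close> by (simp add: normal_density_def g_def exp_add[symmetric] mult_ac)
  qed
  have int: "integrable M (\<lambda>\<omega>. g (Z \<omega>))"
    using distributed_integrable[OF D, of g] \<open>t > 0\<close> by (simp add: tilt)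
  have E: "expectation (\<lambda>\<omega>. g (Z \<omega>)) = exp (\<mu> * t)"
    using distributed_integral[OF D, of g] \<open>t > 0\<close> by (simp add: tilt)
  have AE: "AE \<omega> in M. b t \<omega> = g (Z \<omega>)"
    using price_eq_lognormal[OF assms] by (simp add: g_def Z_def)
  show "integrable M (b t)" using int AE by (subst integrable_cong_AE[of _ M "\<lambda>\<omega>. g (Z \<omega>)"]) auto
  show "expectation (b t) = exp (\<mu> * t)"
    unfolding E[symmetric] using AE by (intro integral_cong_AE) auto
qed

text \<open>
  The normal density is positive everywhere, so the price falls below each level \<open>c\<close> with positive
  probability.
\<close>

lemma price_not_bounded_below:
  assumes p: "price_process M \<mu> \<sigma> w b" and w: "wiener_process M w" and "t > 0" "\<sigma> > 0" "c > 0"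
  shows "\<not> (AE \<omega> in M. c \<le> b t \<omega>)"
proof
  assume AE: "AE \<omega> in M. c \<le> b t \<omega>"
  define Z where "Z \<omega> = w t \<omega> - w 0 \<omega>" for \<omega>
  define z where "z = (ln c - (\<mu> - \<sigma>\<^sup>2 / 2) * t) / \<sigma>"
  have D: "distributed M lborel Z (normal_density 0 (sqrt t))"
    unfolding Z_def by (rule wiener_increment_from_start[OF w \<open>t > 0\<close>])
  have "AE \<omega> in M. z \<le> Z \<omega>"
    using AE price_eq_lognormal[OF p w \<open>t > 0\<close>]
  proof eventually_elim
    case (elim \<omega>)
    have "ln c \<le> ln (b t \<omega>)" using elim(1) \<open>c > 0\<close> by simp
    also have "\<dots> = (\<mu> - \<sigma>\<^sup>2 / 2) * t + \<sigma> * Z \<omega>" unfolding elim(2) Z_def by simp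
    finally have "ln c \<le> (\<mu> - \<sigma>\<^sup>2 / 2) * t + \<sigma> * Z \<omega>" .
    then show ?case
      unfolding z_def pos_divide_le_eq[OF \<open>\<sigma> > 0\<close>] mult.commute[of "Z \<omega>"] by linarith
  qed
  then have "AE x in lborel. 0 < ennreal (normal_density 0 (sqrt t) x) \<longrightarrow> z \<le> x"
    by (subst (asm) distributed_AE2[OF D]) auto
  then have *: "AE x in lborel. z \<le> x"
    using normal_density_pos[of "sqrt t"] \<open>t > 0\<close> by simp
  have "emeasure lborel {z - 1<..<z} = emeasure lborel ({} :: real set)"
    by (rule emeasure_eq_AE) (use * in \<open>auto elim!: eventually_mono\<close>)
  then show False by simp
qed

end


section \<open>Censoring and the expected profit\<close>

context prob_space
begin

text \<open>
  The censor is a definite description, so the equation has to be shown to have exactly one solution. It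
  has one by the intermediate value theorem. If it had two, \<open>c < d\<close>, then capping at \<open>c\<close> and at
  \<open>d\<close> would agree almost surely, so neither would bind and \<open>B\<close> itself would have mean \<open>1\<close>.
\<close>

lemma expectation_min_censor:
  assumes B: "integrable M B" and pos: "AE \<omega> in M. 0 < B \<omega>" and "1 < expectation B"
  shows "expectation (\<lambda>\<omega>. min (B \<omega>) (censor M B)) = 1"
proof -
  define \<phi> where "\<phi> c = expectation (\<lambda>\<omega>. min (B \<omega>) c)" for c
  have [measurable]: "B \<in> borel_measurable M" using B by auto
  have int: "integrable M (\<lambda>\<omega>. min (B \<omega>) c)" for c using B by simp
  have lip: "\<bar>\<phi> c - \<phi> d\<bar> \<le> \<bar>c - d\<bar>" for c d
  proof -
    have "\<bar>\<phi> c - \<phi> d\<bar> = \<bar>expectation (\<lambda>\<omega>. min (B \<omega>) c - min (B \<omega>) d)\<bar>"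
      using int by (simp add: \<phi>_def)
    also have "\<dots> \<le> expectation (\<lambda>\<omega>. \<bar>min (B \<omega>) c - min (B \<omega>) d\<bar>)" by (rule integral_abs_bound)
    also have "\<dots> \<le> expectation (\<lambda>\<omega>. \<bar>c - d\<bar>)"
      using int by (intro integral_mono) (auto simp: min_def)
    finally show ?thesis by (simp add: prob_space)
  qed
  have cont: "continuous_on S \<phi>" for S
    unfolding continuous_on_iff dist_real_def using lip by (meson le_less_trans)
  have "\<phi> 0 = expectation (\<lambda>\<omega>. 0)"
    unfolding \<phi>_def using pos by (intro integral_cong_AE) (auto simp: min_def)
  then have \<phi>0: "\<phi> 0 = 0" by simp
  have "(\<lambda>n. \<phi> (real n)) \<longlonglongrightarrow> expectation B"
    unfolding \<phi>_def
  proof (rule integral_dominated_convergence[where w = B])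
    show "AE \<omega> in M. (\<lambda>n. min (B \<omega>) (real n)) \<longlonglongrightarrow> B \<omega>"
    proof (rule AE_I2)
      fix \<omega>
      obtain N :: nat where "B \<omega> < N" using reals_Archimedean2 by blast
      then have "eventually (\<lambda>n. B \<omega> = min (B \<omega>) (real n)) sequentially"
        by (intro eventually_sequentiallyI[of N]) auto
      from Lim_transform_eventually[OF tendsto_const this]
      show "(\<lambda>n. min (B \<omega>) (real n)) \<longlonglongrightarrow> B \<omega>" .
    qed
    show "AE \<omega> in M. norm (min (B \<omega>) (real n)) \<le> B \<omega>" for n
      using pos by eventually_elim auto
  qed (use B in auto)
  from order_tendstoD(1)[OF this \<open>1 < expectation B\<close>]
  obtain n :: nat where "1 < \<phi> n" by (auto simp: eventually_sequentially)
  then obtain c where c: "\<phi> c = 1"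
    using IVT'[of \<phi> 0 1 n] \<phi>0 cont by auto
  have no_pair: False if "c < d" "\<phi> c = 1" "\<phi> d = 1" for c d
  proof -
    have "expectation (\<lambda>\<omega>. min (B \<omega>) d - min (B \<omega>) c) = 0"
      using that int by (simp add: \<phi>_def)
    then have "AE \<omega> in M. min (B \<omega>) d - min (B \<omega>) c = 0"
      using \<open>c < d\<close> int by (subst (asm) integral_nonneg_eq_0_iff_AE) (auto simp: min_def)
    then have "AE \<omega> in M. min (B \<omega>) c = B \<omega>"
      by eventually_elim (use \<open>c < d\<close> in \<open>auto simp: min_def split: if_splits\<close>)
    then have "\<phi> c = expectation B" unfolding \<phi>_def by (intro integral_cong_AE) auto
    then show False using that \<open>1 < expectation B\<close> by simp
  qed
  have "\<exists>!c. \<phi> c = 1" using c no_pair by (metis linorder_neqE_linordered_idom)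
  from theI'[OF this] show ?thesis unfolding \<phi>_def censor_def .
qed

text \<open>
  The expected excess of the indirect profit over its support line at \<open>m\<close> is the expected profit minus the
  profit at \<open>m\<close>, and the excess is positive wherever \<open>Z \<noteq> m\<close>. The expected profit may be infinite; assuming the
  contrary of the claim makes it finite, which allows passing to the Bochner integral.
\<close>

lemma strict_jensen_indirect_profit:
  assumes f: "inada f" and Z: "integrable M Z" and pos: "AE \<omega> in M. 0 < Z \<omega>"
    and m: "expectation Z = m" "m > 0" and nondeg: "\<not> (AE \<omega> in M. Z \<omega> = m)"
  shows "ennreal (indirect_profit f m) < (\<integral>\<^sup>+\<omega>. ennreal (indirect_profit f (Z \<omega>)) \<partial>M)"
proof (rule ccontr)
  define H where "H p = (if p > 0 then indirect_profit f p else 0)" for p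
  have Hm[measurable]: "H \<in> borel_measurable borel"
    using indirect_profit_measurable[OF f] by (simp add: H_def[abs_def])
  have [measurable]: "Z \<in> borel_measurable M" using Z by auto
  have H0: "0 \<le> H p" for p using indirect_profit_nonneg[OF f] by (simp add: H_def)
  have eq: "(\<integral>\<^sup>+\<omega>. ennreal (indirect_profit f (Z \<omega>)) \<partial>M) = (\<integral>\<^sup>+\<omega>. ennreal (H (Z \<omega>)) \<partial>M)"
    using pos by (intro nn_integral_cong_AE) (auto simp: H_def)
  assume "\<not> ?thesis"
  then have le: "(\<integral>\<^sup>+\<omega>. ennreal (H (Z \<omega>)) \<partial>M) \<le> ennreal (H m)"
    using eq m by (simp add: H_def not_less)
  have int: "integrable M (\<lambda>\<omega>. H (Z \<omega>))"
    by (rule integrableI_nonneg) (use H0 le in \<open>auto intro: le_less_trans\<close>)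
  have E: "expectation (\<lambda>\<omega>. H (Z \<omega>)) \<le> H m"
    using le H0 by (simp add: nn_integral_eq_integral[OF int])
  obtain x where x: "\<And>q. q > 0 \<Longrightarrow> q \<noteq> m \<Longrightarrow> indirect_profit f m - (q - m) * x < indirect_profit f q"
    using indirect_profit_above_support_line[OF f \<open>m > 0\<close>] by metis
  define G where "G \<omega> = H (Z \<omega>) - (H m - (Z \<omega> - m) * x)" for \<omega>
  have key: "0 \<le> H z - (H m - (z - m) * x) \<and> (H z - (H m - (z - m) * x) = 0 \<longrightarrow> z = m)"
    if "z > 0" for z
    using x[OF that] that \<open>m > 0\<close> by (cases "z = m") (auto simp: H_def)
  have G0: "AE \<omega> in M. 0 \<le> G \<omega>" and Gpos: "AE \<omega> in M. G \<omega> = 0 \<longrightarrow> Z \<omega> = m"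
    using pos key unfolding G_def by (auto elim!: eventually_mono)
  have iG: "integrable M G" unfolding G_def using int Z by auto
  have "expectation G = expectation (\<lambda>\<omega>. H (Z \<omega>)) - H m"
    unfolding G_def using int Z m by (simp add: prob_space)
  then have "expectation G = 0"
    using E integral_nonneg_AE[OF G0] by simp
  then have "AE \<omega> in M. G \<omega> = 0"
    using integral_nonneg_eq_0_iff_AE[OF iG G0] by simp
  with Gpos have "AE \<omega> in M. Z \<omega> = m" by eventually_elim simp
  with nondeg show False ..
qed

text \<open>
  On \<open>B \<le> c\<close> the capped price is \<open>B\<close>, elsewhere it is \<open>c\<close>. The detour through \<open>H\<close> is for measurability,
  which additivity of the integral requires.
\<close>

lemma expected_profit_eq_censored:
  assumes f: "inada f" and [measurable]: "B \<in> borel_measurable M" and pos: "AE \<omega> in M. 0 < B \<omega>"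
  shows "expected_profit M f B
    = (\<integral>\<^sup>+\<omega>. ennreal (indirect_profit f (min (B \<omega>) (censor M B))) \<partial>M)"
proof -
  define H where "H p = (if p > 0 then indirect_profit f p else 0)" for p
  have Hm[measurable]: "H \<in> borel_measurable borel"
    using indirect_profit_measurable[OF f] by (simp add: H_def[abs_def])
  define c where "c = censor M B"
  have "expected_profit M f B = (\<integral>\<^sup>+\<omega>. ennreal (H (B \<omega>)) * indicator {\<omega>. B \<omega> \<le> c} \<omega> \<partial>M)
      + ennreal (indirect_profit f c) * emeasure M {\<omega> \<in> space M. B \<omega> > c}"
    unfolding expected_profit_def c_def
    using pos by (intro arg_cong2[where f = "(+)"] nn_integral_cong_AE refl) (auto simp: H_def)
  also have "ennreal (indirect_profit f c) * emeasure M {\<omega> \<in> space M. B \<omega> > c}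
    = (\<integral>\<^sup>+\<omega>. ennreal (indirect_profit f c) * indicator {\<omega> \<in> space M. B \<omega> > c} \<omega> \<partial>M)"
    by (simp add: nn_integral_cmult_indicator)
  also have "(\<integral>\<^sup>+\<omega>. ennreal (H (B \<omega>)) * indicator {\<omega>. B \<omega> \<le> c} \<omega> \<partial>M) + \<dots>
    = (\<integral>\<^sup>+\<omega>. ennreal (H (B \<omega>)) * indicator {\<omega>. B \<omega> \<le> c} \<omega>
        + ennreal (indirect_profit f c) * indicator {\<omega> \<in> space M. B \<omega> > c} \<omega> \<partial>M)"
    by (subst nn_integral_add) (auto simp: indicator_def)
  also have "\<dots> = (\<integral>\<^sup>+\<omega>. ennreal (indirect_profit f (min (B \<omega>) c)) \<partial>M)"
  proof (rule nn_integral_cong_AE)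
    show "AE \<omega> in M. ennreal (H (B \<omega>)) * indicator {\<omega>. B \<omega> \<le> c} \<omega>
        + ennreal (indirect_profit f c) * indicator {\<omega> \<in> space M. B \<omega> > c} \<omega>
      = ennreal (indirect_profit f (min (B \<omega>) c))"
      using pos AE_space by eventually_elim (auto simp: H_def indicator_def min_def)
  qed
  finally show ?thesis unfolding c_def .
qed

end

theorem proposition1:
  fixes M :: "'a measure" and f :: "real \<Rightarrow> real"
    and w b :: "real \<Rightarrow> 'a \<Rightarrow> real" and \<mu>bar \<sigma>bar \<theta> :: real
  assumes "prob_space M"
    and "inada f"
    and "\<mu>bar > 0" and "\<sigma>bar > 0"
    and "wiener_process M w"
    and "price_process M \<mu>bar \<sigma>bar w b"
    and "0 < \<theta>" and "\<theta> < 1"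
  shows "ennreal (indirect_profit f 1) < expected_profit M f (b \<theta>) \<and>
    expected_profit M f (b \<theta>)
      = (\<integral>\<^sup>+\<omega>. ennreal (indirect_profit f (min (b \<theta> \<omega>) (censor M (b \<theta>)))) \<partial>M)"
proof -
  interpret prob_space M by fact
  define c where "c = censor M (b \<theta>)"
  note price = price_has_mean_exp_drift[OF assms(6,5,7)]
  have pos: "AE \<omega> in M. 0 < b \<theta> \<omega>"
    using assms(6,7) unfolding price_process_def by (auto elim: eventually_mono)
  have "1 < expectation (b \<theta>)" using price(2) assms(3,7) by simp
  then have E: "expectation (\<lambda>\<omega>. min (b \<theta> \<omega>) c) = 1"
    using expectation_min_censor[OF price(1) pos] by (simp add: c_def)
  have Z: "integrable M (\<lambda>\<omega>. min (b \<theta> \<omega>) c)" using price(1) by simp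
  have "expectation (\<lambda>\<omega>. min (b \<theta> \<omega>) c) \<le> expectation (\<lambda>\<omega>. c)"
    using Z by (intro integral_mono) auto
  then have "c \<ge> 1" using E by (simp add: prob_space)
  \<comment> \<open>A censored price that is constantly \<open>1\<close> would keep the price itself from falling below \<open>1\<close>.\<close>
  have "\<not> (AE \<omega> in M. min (b \<theta> \<omega>) c = 1)"
  proof
    assume "AE \<omega> in M. min (b \<theta> \<omega>) c = 1"
    then have "AE \<omega> in M. 1 \<le> b \<theta> \<omega>" by eventually_elim linarith
    then show False
      using price_not_bounded_below[OF assms(6,5,7,4), of 1] by simp
  qed
  moreover have "AE \<omega> in M. 0 < min (b \<theta> \<omega>) c" using pos \<open>c \<ge> 1\<close> by auto
  ultimately have "ennreal (indirect_profit f 1)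
      < (\<integral>\<^sup>+\<omega>. ennreal (indirect_profit f (min (b \<theta> \<omega>) c)) \<partial>M)"
    by (intro strict_jensen_indirect_profit[OF assms(2) Z _ E]) auto
  with expected_profit_eq_censored[OF assms(2) borel_measurable_integrable[OF price(1)] pos]
  show ?thesis by (simp add: c_def)
qed

end
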